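(* For the disjunction $\bigvee_{l\in\mathcal D}\big[\,g_l(\boldsymbol x)\le b_l,\ \boldsymbol x\in\mathcal X\,\big]$ with one constraint per disjunct, the $1$-split formulation is equivalent to the big-M formulation in the sense that their continuous relaxations have the same set of feasible $\boldsymbol x$ variables.
   Context: Setting. $\mathcal X\subset\mathbb R^n$ is a convex compact set, $\mathcal D$ is a finite set of disjunct indices, $b_l\in\mathbb R$, and $g_l(\boldsymbol x)=\sum_{i=1}^nh_{i,l}(x_i)$ with $h_{i,l}:\mathbb R\to\mathbb R$ convex; all $g_l$ are bounded on $\mathcal X$; each disjunct $\{\boldsymbol x\in\mathcal X:g_l(\boldsymbol x)\le b_l\}$ is non-empty. $1$-split formulation. For $l\in\mathcal D$ put $\underline\alpha^l=\min_{\boldsymbol x\in\mathcal X}\sum_{i=1}^nh_{i,l}(x_i)$ and $\bar\alpha^l=\max_{\boldsymbol x\in\mathcal X}\sum_{i=1}^nh_{i,l}(x_i)$. The $1$-split formulation has variables $\boldsymbol x\in\mathcal X$, $\alpha^l\in\mathbb R$ ($l\in\mathcal D$), $\nu^{\alpha^l}_d\in\mathbb R$ ($l,d\in\mathcal D$), $\boldsymbol\lambda\in\{0,1\}^{|\mathcal D|}$ and constraints, for all $l,d\in\mathcal D$: $$\alpha^l=\sum_{d'\in\mathcal D}\nu^{\alpha^l}_{d'},\quad \nu^{\alpha^l}_l\le b_l\lambda_l,\quad \underline\alpha^l\lambda_d\le\nu^{\alpha^l}_d\le\bar\alpha^l\lambda_d,\quad \sum_{i=1}^nh_{i,l}(x_i)\le\alpha^l,\quad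 \sum_{l'\in\mathcal D}\lambda_{l'}=1.$$ Big-M formulation. Variables $\boldsymbol x\in\mathcal X$, $\boldsymbol\lambda\in\{0,1\}^{|\mathcal D|}$ with $\sum_{l\in\mathcal D}\lambda_l=1$ and $\sum_{i=1}^nh_{i,l}(x_i)\le b_l+M^l(1-\lambda_l)$ for all $l\in\mathcal D$, where $M^l=\bar\alpha^l-b_l$ is the smallest valid coefficient over $\mathcal X$. The continuous relaxation of either formulation replaces $\boldsymbol\lambda\in\{0,1\}^{|\mathcal D|}$ by $\boldsymbol\lambda\in[0,1]^{|\mathcal D|}$. *)

theory Defs
  imports "HOL-Analysis.Analysis"
begin

definition constr_fun :: "('n::finite \<Rightarrow> 'd \<Rightarrow> real \<Rightarrow> real) \<Rightarrow> 'd \<Rightarrow> real^'n \<Rightarrow> real" where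
  "constr_fun h l x = (\<Sum>i\<in>UNIV. h i l (x $ i))"

text \<open>
  The bounds are the minimum and the maximum of the set of values on \<open>X\<close>. They exist whenever \<open>X\<close> is
  compact and non-empty and the \<open>h i l\<close> are convex on the whole line, hence continuous.
\<close>

definition alpha_lower :: "(real^'n::finite) set \<Rightarrow> ('n \<Rightarrow> 'd \<Rightarrow> real \<Rightarrow> real) \<Rightarrow> 'd \<Rightarrow> real" where
  "alpha_lower X h l = (LEAST v. v \<in> constr_fun h l ` X)"

definition alpha_upper :: "(real^'n::finite) set \<Rightarrow> ('n \<Rightarrow> 'd \<Rightarrow> real \<Rightarrow> real) \<Rightarrow> 'd \<Rightarrow> real" where
  "alpha_upper X h l = (GREATEST v. v \<in> constr_fun h l ` X)"

definition bigM_coeff ::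
  "(real^'n::finite) set \<Rightarrow> ('n \<Rightarrow> 'd \<Rightarrow> real \<Rightarrow> real) \<Rightarrow> ('d \<Rightarrow> real) \<Rightarrow> 'd \<Rightarrow> real" where
  "bigM_coeff X h b l = alpha_upper X h l - b l"

text \<open>
  In both formulations the parameter \<open>L\<close> is the domain of each \<open>lam l\<close>: \<open>{0, 1}\<close> gives the mixed-integer
  formulation and \<open>{0..1}\<close> its continuous relaxation. The variable \<open>\<nu> l d\<close> is the copy of \<open>\<alpha> l\<close>
  belonging to disjunct \<open>d\<close>. Values of \<open>\<alpha>\<close>, \<open>\<nu>\<close>, \<open>lam\<close> at indices outside \<open>D\<close> are unconstrained and
  carry no meaning.
\<close>

definition one_split_over ::
  "real set \<Rightarrow> (real^'n::finite) set \<Rightarrow> 'd set \<Rightarrow> ('n \<Rightarrow> 'd \<Rightarrow> real \<Rightarrow> real) \<Rightarrow> ('d \<Rightarrow> real)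
    \<Rightarrow> ((real^'n) \<times> ('d \<Rightarrow> real) \<times> ('d \<Rightarrow> 'd \<Rightarrow> real) \<times> ('d \<Rightarrow> real)) set" where
  "one_split_over L X D h b = {(x, \<alpha>, \<nu>, lam).
     x \<in> X \<and>
     (\<forall>l\<in>D. lam l \<in> L) \<and>
     (\<forall>l\<in>D. \<alpha> l = (\<Sum>d\<in>D. \<nu> l d)) \<and>
     (\<forall>l\<in>D. \<nu> l l \<le> b l * lam l) \<and>
     (\<forall>l\<in>D. \<forall>d\<in>D. alpha_lower X h l * lam d \<le> \<nu> l d \<and> \<nu> l d \<le> alpha_upper X h l * lam d) \<and>
     (\<forall>l\<in>D. constr_fun h l x \<le> \<alpha> l) \<and>
     (\<Sum>l\<in>D. lam l) = 1}"

definition bigM_over ::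
  "real set \<Rightarrow> (real^'n::finite) set \<Rightarrow> 'd set \<Rightarrow> ('n \<Rightarrow> 'd \<Rightarrow> real \<Rightarrow> real) \<Rightarrow> ('d \<Rightarrow> real)
    \<Rightarrow> ((real^'n) \<times> ('d \<Rightarrow> real)) set" where
  "bigM_over L X D h b = {(x, lam).
     x \<in> X \<and>
     (\<forall>l\<in>D. lam l \<in> L) \<and>
     (\<forall>l\<in>D. constr_fun h l x \<le> b l + bigM_coeff X h b l * (1 - lam l)) \<and>
     (\<Sum>l\<in>D. lam l) = 1}"

abbreviation "one_split_formulation \<equiv> one_split_over {0, 1}"
abbreviation "one_split_relaxation \<equiv> one_split_over {0..1}"
abbreviation "bigM_formulation \<equiv> bigM_over {0, 1}"
abbreviation "bigM_relaxation \<equiv> bigM_over {0..1}"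

text \<open>The set of feasible \<open>x\<close> is the projection onto the first component.\<close>

abbreviation feasible_x :: "('x \<times> 'y) set \<Rightarrow> 'x set" where
  "feasible_x F \<equiv> fst ` F"

end

theory Submission
  imports Defs
begin

text \<open>
  Fix \<open>x\<close> and \<open>lam\<close>. The two relaxations differ only in the variables \<open>\<alpha>\<close> and \<open>\<nu>\<close>, which for each
  \<open>l\<close> serve as an upper estimate \<open>\<alpha> l\<close> of \<open>g\<^sub>l(x)\<close>. The largest estimate the 1-split constraints permit
  is obtained by pushing every \<open>\<nu> l d\<close> to its upper bound. If \<open>b l \<le> alpha_upper l\<close>, then, since the
  multipliers add up to one, this gives \<open>b l * lam l + alpha_upper l * (1 - lam l)\<close>, which is just another way of writing
  the big-M right-hand side \<open>b l + M l * (1 - lam l)\<close>. Hence eliminating \<open>\<alpha>\<close> and \<open>\<nu>\<close> from the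
  1-split relaxation leaves the big-M relaxation, with the same multipliers.

  Two points need care. The bound on \<open>\<nu> l l\<close> is really \<open>min (b l) (alpha_upper l) * lam l\<close>; if
  the minimum is \<open>alpha_upper l\<close>, then the best estimate is \<open>alpha_upper l\<close> itself, which is valid for
  every \<open>x\<close> in \<open>X\<close>. And these upper bounds must not drop below the lower bounds
  \<open>alpha_lower l * lam d\<close>, which holds because the disjunct is non-empty, so that
  \<open>alpha_lower l \<le> b l\<close>.
  That \<open>alpha_lower\<close> and \<open>alpha_upper\<close> actually bound the constraint functions on \<open>X\<close> comes from
  compactness of \<open>X\<close> and continuity of finite convex functions.
\<close>

lemma constr_fun_continuous_on:
  fixes h :: "'n::finite \<Rightarrow> 'd \<Rightarrow> real \<Rightarrow> real"
  assumes "\<And>i. convex_on UNIV (h i l)"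
  shows "continuous_on S (constr_fun h l)"
proof -
  have "continuous_on UNIV (h i l)" for i
    using assms by (intro convex_on_continuous) auto
  then have "continuous_on S (\<lambda>x. h i l (x $ i))" for i
    by (rule continuous_on_compose2) (auto intro!: continuous_intros)
  then show ?thesis
    unfolding constr_fun_def by (intro continuous_on_sum)
qed

text \<open>
  \<open>Least\<close> and \<open>Greatest\<close> are meaningful only when the extremum is attained; the image of
  \<open>X\<close> is compact, so both extrema are.
\<close>

lemma alpha_bounds:
  fixes h :: "'n::finite \<Rightarrow> 'd \<Rightarrow> real \<Rightarrow> real"
  assumes "compact X" and "\<And>i. convex_on UNIV (h i l)" and "x \<in> X"
  shows "alpha_lower X h l \<le> constr_fun h l x" and "constr_fun h l x \<le> alpha_upper X h l"
proof -
  let ?V = "constr_fun h l ` X"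
  have V: "compact ?V" "?V \<noteq> {}"
    using assms by (auto intro: compact_continuous_image constr_fun_continuous_on)
  obtain m where m: "m \<in> ?V" "\<forall>v\<in>?V. m \<le> v"
    using compact_attains_inf[OF V] by blast
  obtain M where M: "M \<in> ?V" "\<forall>v\<in>?V. v \<le> M"
    using compact_attains_sup[OF V] by blast
  have "alpha_lower X h l = m"
    unfolding alpha_lower_def using m by (intro Least_equality) auto
  then show "alpha_lower X h l \<le> constr_fun h l x"
    using m assms(3) by auto
  have "alpha_upper X h l = M"
    unfolding alpha_upper_def using M by (intro Greatest_equality) auto
  then show "constr_fun h l x \<le> alpha_upper X h l"
    using M assms(3) by auto
qed

lemma bigM_rhs_eq:
  "b l + bigM_coeff X h b l * (1 - lam l) = b l * lam l + alpha_upper X h l * (1 - lam l)"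
  by (simp add: bigM_coeff_def algebra_simps)

lemma sum_unit_but_one:
  fixes lam :: "'d \<Rightarrow> real"
  assumes "finite D" and "l \<in> D" and "(\<Sum>d\<in>D. lam d) = 1"
  shows "(\<Sum>d\<in>D - {l}. c * lam d) = c * (1 - lam l)"
proof -
  have "(\<Sum>d\<in>D - {l}. lam d) = 1 - lam l"
    using assms by (simp add: sum_diff1)
  then show ?thesis
    by (simp flip: sum_distrib_left)
qed

text \<open>
  Summing the individual upper bounds on \<open>\<nu> l d\<close> bounds \<open>\<alpha> l\<close> by the big-M right-hand side.
\<close>

lemma bigM_over_if_one_split_over:
  assumes "finite D" and "(x, \<alpha>, \<nu>, lam) \<in> one_split_over L X D h b"
  shows "(x, lam) \<in> bigM_over L X D h b"
proof -
  have sum1: "(\<Sum>d\<in>D. lam d) = 1"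
    using assms(2) by (simp add: one_split_over_def)
  have "constr_fun h l x \<le> b l + bigM_coeff X h b l * (1 - lam l)" if "l \<in> D" for l
  proof -
    have "constr_fun h l x \<le> (\<Sum>d\<in>D. \<nu> l d)"
      using assms(2) that by (auto simp: one_split_over_def)
    also have "\<dots> = \<nu> l l + (\<Sum>d\<in>D - {l}. \<nu> l d)"
      using assms(1) that by (simp add: sum.remove)
    also have "\<dots> \<le> b l * lam l + (\<Sum>d\<in>D - {l}. alpha_upper X h l * lam d)"
      using assms(2) that by (intro add_mono sum_mono) (auto simp: one_split_over_def)
    also have "\<dots> = b l + bigM_coeff X h b l * (1 - lam l)"
      by (simp add: sum_unit_but_one[OF assms(1) that sum1] bigM_rhs_eq)
    finally show ?thesis .
  qed
  then show ?thesis
    using assms(2) by (simp add: one_split_over_def bigM_over_def)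
qed

text \<open>
  Conversely, putting every \<open>\<nu> l d\<close> at its largest permitted value makes \<open>\<alpha> l\<close> large enough to
  absorb the big-M constraint. Nonnegative multipliers keep the lower and upper bounds on
  \<open>\<nu>\<close> in the right order after scaling by \<open>lam d\<close>.
\<close>

lemma one_split_over_if_bigM_over:
  assumes "finite D" and "L \<subseteq> {0..}"
    and lower: "\<And>l y. l \<in> D \<Longrightarrow> y \<in> X \<Longrightarrow> alpha_lower X h l \<le> constr_fun h l y"
    and upper: "\<And>l y. l \<in> D \<Longrightarrow> y \<in> X \<Longrightarrow> constr_fun h l y \<le> alpha_upper X h l"
    and nonempty: "\<And>l. l \<in> D \<Longrightarrow> {y \<in> X. constr_fun h l y \<le> b l} \<noteq> {}"
    and bigM: "(x, lam) \<in> bigM_over L X D h b"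
  shows "\<exists>\<alpha> \<nu>. (x, \<alpha>, \<nu>, lam) \<in> one_split_over L X D h b"
proof -
  define \<nu> where
    "\<nu> l d = (if d = l then min (b l) (alpha_upper X h l) else alpha_upper X h l) * lam d" for l d
  define \<alpha> where "\<alpha> l = (\<Sum>d\<in>D. \<nu> l d)" for l
  have x: "x \<in> X" and sum1: "(\<Sum>d\<in>D. lam d) = 1" and lam_L: "\<forall>l\<in>D. lam l \<in> L"
    and con: "\<And>l. l \<in> D \<Longrightarrow> constr_fun h l x \<le> b l * lam l + alpha_upper X h l * (1 - lam l)"
    using bigM by (simp_all add: bigM_over_def bigM_rhs_eq)
  have lam_nonneg: "0 \<le> lam d" if "d \<in> D" for d
    using that lam_L assms(2) by auto
  have lower_le: "alpha_lower X h l \<le> min (b l) (alpha_upper X h l)" if l: "l \<in> D" for l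
  proof -
    obtain y where "y \<in> X" "constr_fun h l y \<le> b l"
      using nonempty[OF l] by blast
    then show ?thesis
      using lower[OF l, of y] upper[OF l, of y] by linarith
  qed
  have own: "\<nu> l l \<le> b l * lam l" if "l \<in> D" for l
    using lam_nonneg[OF that] by (simp add: \<nu>_def mult_right_mono)
  have bounds: "alpha_lower X h l * lam d \<le> \<nu> l d \<and> \<nu> l d \<le> alpha_upper X h l * lam d"
    if "l \<in> D" "d \<in> D" for l d
    using lower_le[OF that(1)] lam_nonneg[OF that(2)] by (simp add: \<nu>_def mult_right_mono)
  have estimate: "constr_fun h l x \<le> \<alpha> l" if l: "l \<in> D" for l
  proof -
    have "\<alpha> l = \<nu> l l + (\<Sum>d\<in>D - {l}. \<nu> l d)"
      using assms(1) l by (simp add: \<alpha>_def sum.remove)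
    also have "(\<Sum>d\<in>D - {l}. \<nu> l d) = (\<Sum>d\<in>D - {l}. alpha_upper X h l * lam d)"
      by (intro sum.cong) (auto simp: \<nu>_def)
    finally have \<alpha>: "\<alpha> l = min (b l) (alpha_upper X h l) * lam l + alpha_upper X h l * (1 - lam l)"
      by (simp add: sum_unit_but_one[OF assms(1) l sum1] \<nu>_def)
    show ?thesis
    proof (cases "b l \<le> alpha_upper X h l")
      case True
      then show ?thesis
        using con[OF l] \<alpha> by simp
    next
      case False
      then have "\<alpha> l = alpha_upper X h l"
        using \<alpha> by (simp add: algebra_simps)
      then show ?thesis
        using upper[OF l x] by simp
    qed
  qed
  have "(x, \<alpha>, \<nu>, lam) \<in> one_split_over L X D h b"
    using x sum1 lam_L own bounds estimate by (simp add: one_split_over_def \<alpha>_def)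
  then show ?thesis
    by blast
qed

theorem theorem1:
  fixes X :: "(real^'n::finite) set" and D :: "'d set"
    and h :: "'n \<Rightarrow> 'd \<Rightarrow> real \<Rightarrow> real" and b :: "'d \<Rightarrow> real"
  assumes "convex X" and "compact X"
    and "finite D"
    and "\<And>i l. l \<in> D \<Longrightarrow> convex_on UNIV (h i l)"
    and "\<And>l. l \<in> D \<Longrightarrow> bounded (constr_fun h l ` X)"
    and "\<And>l. l \<in> D \<Longrightarrow> {x \<in> X. constr_fun h l x \<le> b l} \<noteq> {}"
  shows "feasible_x (one_split_relaxation X D h b) = feasible_x (bigM_relaxation X D h b)"
proof (intro subset_antisym subsetI)
  fix x assume "x \<in> feasible_x (one_split_relaxation X D h b)"
  then obtain \<alpha> \<nu> lam where "(x, \<alpha>, \<nu>, lam) \<in> one_split_relaxation X D h b"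
    by auto
  then have "(x, lam) \<in> bigM_relaxation X D h b"
    by (rule bigM_over_if_one_split_over[OF assms(3)])
  then show "x \<in> feasible_x (bigM_relaxation X D h b)"
    by force
next
  fix x assume "x \<in> feasible_x (bigM_relaxation X D h b)"
  then obtain lam where "(x, lam) \<in> bigM_relaxation X D h b"
    by auto
  then have "\<exists>\<alpha> \<nu>. (x, \<alpha>, \<nu>, lam) \<in> one_split_relaxation X D h b"
    using assms(3)
    by (rule one_split_over_if_bigM_over[rotated -1]) (use assms in \<open>auto intro: alpha_bounds\<close>)
  then show "x \<in> feasible_x (one_split_relaxation X D h b)"
    by force
qed

end
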